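(* Let $p$ be an odd integer (not necessarily prime), let $s,t$ be integers with $1 \le s,t \le p-1$, and let $B = \{0,1,\dots,t-1\} \subseteq \mathbb{Z}_p$. Define \[ f(s,t) = \begin{cases} 0 & \text{if } 2t \le p-s+1,\\ \left\lfloor \frac{(s+2t-p)^2}{4}\right\rfloor & \text{if } p-s+2 \le 2t \le p+s-2,\\ s(2t-p) & \text{if } p+s-1 \le 2t,\end{cases} \qquad g(s,t) = \begin{cases} t^2 & \text{if } 2t \le s,\\ \left\lceil \frac{s(4t-s)}{4}\right\rceil & \text{if } s+1 \le 2t \le 2p-s-1,\\ s(2t-p)+(p-t)^2 & \text{if } 2p-s \le 2t.\end{cases} \] Then for every integer $r$ with $f(s,t) \le r \le g(s,t)$ there is a subset $A$ of $\mathbb{Z}_p$ with $|A| = s$ and $r(A,B,B) = r$.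
   Context: $\mathbb{Z}_p$ is the additive group of integers modulo $p$. $r(A,B,B)$ denotes the number of triples $(a,b,a+b)$ with $a\in A$, $b\in B$ and $a+b\in B$. *)

theory Defs
  imports Complex_Main "HOL-Algebra.Elementary_Groups"
begin

text \<open>
  The group \<open>\<int>\<^sub>p\<close> is \<^term>\<open>integer_mod_group (nat p)\<close>, which for \<open>p > 0\<close> has carrier \<open>{0..<p}\<close> and
  addition modulo \<open>p\<close>; the group operation is written multiplicatively in HOL-Algebra.
\<close>

definition additive_triples :: "('a, 'b) monoid_scheme \<Rightarrow> 'a set \<Rightarrow> 'a set \<Rightarrow> 'a set \<Rightarrow> ('a \<times> 'a \<times> 'a) set"
  where "additive_triples G A B C =
    {(a, b, a \<otimes>\<^bsub>G\<^esub> b) | a b. a \<in> A \<and> b \<in> B \<and> a \<otimes>\<^bsub>G\<^esub> b \<in> C}"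

definition r_count :: "('a, 'b) monoid_scheme \<Rightarrow> 'a set \<Rightarrow> 'a set \<Rightarrow> 'a set \<Rightarrow> nat"
  where "r_count G A B C = card (additive_triples G A B C)"

definition f_bound :: "int \<Rightarrow> int \<Rightarrow> int \<Rightarrow> int"
  where "f_bound p s t =
    (if 2 * t \<le> p - s + 1 then 0
     else if 2 * t \<le> p + s - 2 then \<lfloor>(real_of_int (s + 2 * t - p))\<^sup>2 / 4\<rfloor>
     else s * (2 * t - p))"

definition g_bound :: "int \<Rightarrow> int \<Rightarrow> int \<Rightarrow> int"
  where "g_bound p s t =
    (if 2 * t \<le> s then t\<^sup>2
     else if 2 * t \<le> 2 * p - s - 1 then \<lceil>real_of_int (s * (4 * t - s)) / 4\<rceil>
     else s * (2 * t - p) + (p - t)\<^sup>2)"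

end

theory Submission
  imports Defs
begin

text \<open>
  A difference \<open>a\<close> contributes \<open>w a = \<bar>B \<inter> (B - a)\<bar>\<close> triples, and since \<open>B\<close> is an interval,
  \<open>w a = max (t - \<bar>a\<bar>) (max 0 (2t - p))\<close>, where \<open>\<bar>a\<bar>\<close> is the distance from \<open>a\<close> to \<open>0\<close> in \<open>\<int>\<^sub>p\<close>.
  In the order \<open>0, -1, 1, -2, 2, \<dots>\<close> these weights decrease by steps of \<open>0\<close> or \<open>1\<close>, so moving the
  elements of \<open>A\<close> one place at a time takes the \<open>s\<close> smallest weights to the \<open>s\<close> largest ones and
  every intermediate sum occurs. The extreme sums are \<open>f\<close> and \<open>g\<close>.
\<close>

section \<open>Intermediate sums by moving one index at a time\<close>

lemma card_downward_closed_eq_lessThan: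
  fixes A :: "nat set"
  assumes "finite A" and "\<And>i. Suc i \<in> A \<Longrightarrow> i \<in> A"
  shows "A = {..<card A}"
proof -
  have down: "j \<in> A" if "i \<in> A" "j \<le> i" for i j
    using that(2,1)
  proof (induction rule: inc_induct)
    case (step k)
    then show ?case
      using assms(2) by blast
  qed
  show ?thesis
  proof (cases "A = {}")
    case False
    then have "A = {..Max A}"
      using assms(1) by (auto intro: down[OF Max_in])
    then have "card A = Suc (Max A)"
      by (metis card_atMost)
    with \<open>A = {..Max A}\<close> show ?thesis
      by (simp add: lessThan_Suc_atMost)
  qed simp
qed

text \<open>While the sum is below \<open>r\<close>, \<open>A\<close> is not an initial segment, so
  some \<open>Suc i\<close> in \<open>A\<close> has \<open>i\<close> outside \<open>A\<close>.
  Replacing it by \<open>i\<close> raises the sum by 0 or 1, so \<open>r\<close> cannot be overshot,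
  and lowers the sum of the indices, which gives termination.\<close>

lemma subset_sum_between:
  fixes v :: "nat \<Rightarrow> int"
  assumes step: "\<And>i. Suc i < n \<Longrightarrow> v (Suc i) \<le> v i \<and> v i \<le> v (Suc i) + 1"
    and "A \<subseteq> {..<n}" "sum v A \<le> r" "r \<le> sum v {..<card A}"
  shows "\<exists>C \<subseteq> {..<n}. card C = card A \<and> sum v C = r"
  using assms(2-)
proof (induction "\<Sum>A" arbitrary: A rule: less_induct)
  case less
  have fin: "finite A"
    by (rule finite_subset[OF less.prems(1)]) simp
  show ?case
  proof (cases "sum v A = r")
    case False
    with less.prems(2,3) have "sum v A \<noteq> sum v {..<card A}"
      by linarith
    then have "A \<noteq> {..<card A}"
      by metis
    then obtain i where i: "Suc i \<in> A" "i \<notin> A"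
      using card_downward_closed_eq_lessThan[OF fin] by blast
    define A' where "A' = insert i (A - {Suc i})"
    have card: "card A' = card A"
      using fin i card_Suc_Diff1[OF fin i(1)] by (simp add: A'_def)
    have sum: "sum g A' + g (Suc i) = sum g A + g i" for g :: "nat \<Rightarrow> int"
      using fin i by (simp add: A'_def sum.remove[of A "Suc i" g])
    have sum_nat: "\<Sum>A' + Suc i = \<Sum>A + i"
      using fin i by (simp add: A'_def sum.remove[of A "Suc i"])
    have "Suc i < n"
      using i less.prems(1) by auto
    have "\<exists>C \<subseteq> {..<n}. card C = card A' \<and> sum v C = r"
    proof (rule less.hyps)
      show "\<Sum>A' < \<Sum>A"
        using sum_nat by simp
      show "A' \<subseteq> {..<n}"
        using less.prems(1) \<open>Suc i < n\<close> by (auto simp: A'_def)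
      show "sum v A' \<le> r"
        using sum[of v] step[OF \<open>Suc i < n\<close>] False less.prems(2) by linarith
      show "r \<le> sum v {..<card A'}"
        using less.prems(3) card by simp
    qed
    then show ?thesis
      by (simp add: card)
  qed (use less.prems in auto)
qed

section \<open>Closed forms of truncated staircase sums\<close>

text \<open>The subtracted terms 0, 1, 1, 2, 2, ... have partial sums \<open>s^2 div 4\<close>. Once
  every positive term is included, the total is u + 2((u - 1) + ... + 1) = u^2.\<close>

lemma sum_max_diff_half:
  fixes u :: int
  assumes "0 \<le> u"
  shows "(\<Sum>i<s. max (u - int (Suc i div 2)) 0) =
    (if 2 * u \<le> int s then u\<^sup>2 else int s * u - (int s)\<^sup>2 div 4)"
proof (induction s)
  case (Suc s)
  show ?case
  proof (cases "even s")
    case True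
    then obtain k where "s = 2 * k" by blast
    moreover have "(1 + 2 * int k)\<^sup>2 = 4 * ((int k)\<^sup>2 + int k) + 1" "(2 * int k)\<^sup>2 = 4 * (int k)\<^sup>2"
      by (simp_all add: power2_eq_square algebra_simps)
    then have "(1 + 2 * int k)\<^sup>2 div 4 = (int k)\<^sup>2 + int k" "(2 * int k)\<^sup>2 div 4 = (int k)\<^sup>2"
      by presburger+
    ultimately show ?thesis
      using Suc by (auto simp: max_def algebra_simps power2_eq_square)
  next
    case False
    then obtain k where "s = 2 * k + 1" using oddE by blast
    moreover have "(1 + 2 * int k)\<^sup>2 = 4 * ((int k)\<^sup>2 + int k) + 1"
      "(2 + 2 * int k)\<^sup>2 = 4 * ((int k + 1)\<^sup>2)"
      by (simp_all add: power2_eq_square algebra_simps)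
    then have "(1 + 2 * int k)\<^sup>2 div 4 = (int k)\<^sup>2 + int k" "(2 + 2 * int k)\<^sup>2 div 4 = (int k + 1)\<^sup>2"
      by presburger+
    ultimately show ?thesis
      \<comment> \<open>At \<open>u = int k + 1\<close> the induction step passes from one branch to
        the other.\<close>
      using Suc by (cases "u = int k + 1") (auto simp: max_def algebra_simps power2_eq_square)
  qed
qed (use assms in auto)

text \<open>The positive terms are 1, 1, 2, 2, ..., starting at \<open>j = 2 * d + 2\<close>; the
  first n of them add up to the floor of (n + 1)^2 / 4, here with n = s - 2d - 2.\<close>

lemma sum_max_half_diff:
  fixes d :: int
  assumes "0 \<le> d"
  shows "(\<Sum>j<s. max (int (j div 2) - d) 0) =
    (if int s \<le> 2 * d + 1 then 0 else (int s - 2 * d - 1)\<^sup>2 div 4)"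
proof (induction s)
  case (Suc s)
  show ?case
  proof (cases "even s")
    case True
    then obtain k where s: "s = 2 * k" by blast
    define e where "e = int k - d"
    have "(2 * e)\<^sup>2 = 4 * e\<^sup>2" "(2 * e - 1)\<^sup>2 = 4 * (e\<^sup>2 - e) + 1"
      by (simp_all add: power2_eq_square algebra_simps)
    then have "(2 * e)\<^sup>2 div 4 = e\<^sup>2" "(2 * e - 1)\<^sup>2 div 4 = e\<^sup>2 - e"
      by presburger+
    moreover have "int k = e + d" "int (Suc s) - 2 * d - 1 = 2 * e" "int s - 2 * d - 1 = 2 * e - 1"
      by (simp_all add: s e_def)
    ultimately show ?thesis
      using Suc by (auto simp: s max_def)
  next
    case False
    then obtain k where s: "s = 2 * k + 1" using oddE by blast
    define e where "e = int k - d"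
    have "(2 * e)\<^sup>2 = 4 * e\<^sup>2" "(1 + 2 * e)\<^sup>2 = 4 * (e\<^sup>2 + e) + 1"
      by (simp_all add: power2_eq_square algebra_simps)
    then have "(2 * e)\<^sup>2 div 4 = e\<^sup>2" "(1 + 2 * e)\<^sup>2 div 4 = e\<^sup>2 + e"
      by presburger+
    moreover have "int k = e + d" "int (Suc s) - 2 * d - 1 = 1 + 2 * e" "int s - 2 * d - 1 = 2 * e"
      by (simp_all add: s e_def)
    ultimately show ?thesis
      using Suc by (cases "e = 0") (auto simp: s max_def)
  qed
qed (use assms in auto)

section \<open>Weights and their extreme sums\<close>

text \<open>In the order 0, -1, 1, -2, 2, ... the residue at place \<open>i\<close> has distance
  \<open>Suc i div 2\<close> from 0.\<close>

definition weight :: "int \<Rightarrow> int \<Rightarrow> nat \<Rightarrow> int"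
  where "weight p t i = max (t - int (Suc i div 2)) (max 0 (2 * t - p))"

lemma weight_eq:
  "weight p t i = max 0 (2 * t - p) + max (min t (p - t) - int (Suc i div 2)) 0"
  unfolding weight_def by auto

text \<open>Read from the far end, the distances are m, m, m - 1, m - 1, ..., and the amount
  subtracted from \<open>j div 2\<close> is \<open>m - min t (p - t)\<close>.\<close>

lemma weight_eq_reversed:
  assumes "p = 2 * m + 1" "int i + int j = 2 * m"
  shows "weight p t i = max 0 (2 * t - p) + max (int (j div 2) - (if t \<le> m then m - t else t - m - 1)) 0"
proof -
  have "int (Suc i div 2) = m - int (j div 2)"
    using assms(2) by presburger
  then show ?thesis
    unfolding weight_def using assms(1) by auto
qed

lemma sum_weight_top:
  assumes "1 \<le> t" "t \<le> p - 1" "int s \<le> p - 1"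
  shows "(\<Sum>i<s. weight p t i) = g_bound p (int s) t"
proof -
  define u where "u = min t (p - t)"
  have "0 \<le> u"
    using assms by (simp add: u_def)
  have ceil: "\<lceil>real_of_int (int s * (4 * t - int s)) / 4\<rceil> = int s * t - (int s)\<^sup>2 div 4"
  proof -
    have "\<lceil>real_of_int (int s * (4 * t - int s)) / real_of_int 4\<rceil>
        = - (- (int s * (4 * t - int s)) div 4)"
      by (rule ceiling_divide_eq_div)
    moreover have "- (int s * (4 * t - int s)) = (int s)\<^sup>2 + - (int s * t) * 4"
      by (simp add: power2_eq_square algebra_simps)
    ultimately show ?thesis
      by simp
  qed
  \<comment> \<open>Since \<open>max 0 (2 * t - p) + u = t\<close>, the branch with
    \<open>2 * u > s\<close> becomes the middle case of \<open>g_bound\<close> for either value of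
    \<open>u\<close>.\<close>
  have "(\<Sum>i<s. weight p t i) = int s * max 0 (2 * t - p) +
      (if 2 * u \<le> int s then u\<^sup>2 else int s * u - (int s)\<^sup>2 div 4)"
    by (simp add: weight_eq u_def[symmetric] sum.distrib sum_max_diff_half[OF \<open>0 \<le> u\<close>])
  also have "\<dots> = g_bound p (int s) t"
    unfolding g_bound_def ceil u_def using assms
    by (auto simp: min_def max_def algebra_simps)
  finally show ?thesis .
qed

lemma sum_weight_bottom:
  assumes "odd p" "1 \<le> t" "t \<le> p - 1" "1 \<le> s" "int s \<le> p - 1"
  shows "sum (weight p t) {nat p - s..<nat p} = f_bound p (int s) t"
proof -
  obtain m where m: "p = 2 * m + 1"
    using assms(1) oddE by blast
  define d where "d = (if t \<le> m then m - t else t - m - 1)"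
  have "sum (weight p t) {nat p - s..<nat p} = (\<Sum>j<s. weight p t (nat p - 1 - j))"
    using assms by (intro sum.reindex_bij_witness[of _ "\<lambda>j. nat p - 1 - j" "\<lambda>i. nat p - 1 - i"]) auto
  also have "\<dots> = (\<Sum>j<s. max 0 (2 * t - p) + max (int (j div 2) - d) 0)"
    unfolding d_def using assms by (intro sum.cong refl weight_eq_reversed[OF m]) (auto simp: m)
  also have "\<dots> = int s * max 0 (2 * t - p) +
      (if int s \<le> 2 * d + 1 then 0 else (int s - 2 * d - 1)\<^sup>2 div 4)"
    using assms by (simp add: sum.distrib sum_max_half_diff d_def)
  also have "\<dots> = f_bound p (int s) t"
  proof -
    have fl: "\<lfloor>(real_of_int x)\<^sup>2 / 4\<rfloor> = x\<^sup>2 div 4" for x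
      using floor_divide_of_int_eq[of "x\<^sup>2" 4, where 'a = real] by simp
    show ?thesis
    proof (cases "t \<le> m")
      case True
      have e: "int s - 2 * d - 1 = int s + 2 * t - p" "2 * d + 1 = p - 2 * t" "2 * t - p \<le> 0"
        using True by (auto simp: d_def m)
      \<comment> \<open>The zero case of \<open>f_bound\<close> reaches one value further than that
        of the closed form; there the quarter square is \<open>1 div 4\<close>.\<close>
      have "(int s + 2 * t - p)\<^sup>2 div 4 = 0" if "2 * t \<le> p - int s + 1" "\<not> int s \<le> p - 2 * t"
      proof -
        have "int s + 2 * t - p = 1"
          using that by linarith
        then show ?thesis
          by simp
      qed
      then show ?thesis
        unfolding f_bound_def fl e(1,2) using assms(4,5) e(3) by (auto simp: max_def)
    next
      case False
      define k where "k = 2 * t - p"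
      have e: "int s - 2 * d - 1 = int s - k" "2 * d + 1 = k" "1 \<le> k"
        using False by (auto simp: d_def m k_def)
      \<comment> \<open>Absorbs the constant part \<open>s * k\<close> of the weights into the
        quarter square of \<open>f_bound\<close>.\<close>
      have "(int s + k)\<^sup>2 = (int s - k)\<^sup>2 + (int s * k) * 4"
        by (simp add: power2_eq_square algebra_simps)
      then have q: "(int s + k)\<^sup>2 div 4 = (int s - k)\<^sup>2 div 4 + int s * k"
        by simp
      have shift: "int s + 2 * t - p = int s + k" "2 * t = p + k"
        by (simp_all add: k_def)
      have "(int s - k)\<^sup>2 div 4 = 0" if "\<not> int s \<le> k" "\<not> p + k \<le> p + int s - 2"
      proof -
        have "int s - k = 1"
          using that by linarith
        then show ?thesis
          by simp
      qed
      then show ?thesis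
        unfolding f_bound_def fl e(1,2) shift using assms e(3) q by auto
    qed
  qed
  finally show ?thesis .
qed

section \<open>Weights as counts of triples in the cyclic group\<close>

definition alternating :: "int \<Rightarrow> nat \<Rightarrow> int"
  where "alternating p i = (if even i then int (i div 2) else p - int (Suc i div 2))"

lemma alternating_range: "int i < p \<Longrightarrow> alternating p i \<in> {0..<p}"
  unfolding alternating_def by auto

text \<open>Even places take values below p/2, odd places values of at least p/2.\<close>

lemma inj_on_alternating: "inj_on (alternating p) {..<nat p}"
proof (rule inj_onI)
  fix i j
  assume *: "i \<in> {..<nat p}" "j \<in> {..<nat p}" "alternating p i = alternating p j"
  then have "int i < p" "int j < p"
    by auto
  with *(3) show "i = j"
    unfolding alternating_def by (cases "even i"; cases "even j") (simp_all, presburger+)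
qed

text \<open>The two summands count the \<open>b\<close> for which \<open>a + b\<close> stays below
  \<open>p\<close> and those for which it wraps around once; each set is an interval.\<close>

lemma card_interval_shift:
  fixes p t a :: int
  assumes "t \<le> p - 1" "a \<in> {0..<p}"
  shows "card {b \<in> {0..t - 1}. (a + b) mod p \<in> {0..t - 1}} = nat (t - a) + nat (t - p + a)"
proof -
  have "(a + b) mod p = (if a + b < p then a + b else a + b - p)" if "b \<in> {0..t - 1}" for b
    using that assms mod_pos_pos_trivial[of "a + b" p] mod_pos_pos_trivial[of "a + b - p" p]
    by auto
  then have "{b \<in> {0..t - 1}. (a + b) mod p \<in> {0..t - 1}} = {0..t - 1 - a} \<union> {p - a..t - 1}"
    using assms by (auto split: if_splits)
  moreover have "card ({0..t - 1 - a} \<union> {p - a..t - 1}) = nat (t - a) + nat (t - p + a)"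
    using assms by (subst card_Un_disjoint) auto
  ultimately show ?thesis
    by simp
qed

lemma card_interval_shift_alternating:
  assumes "1 \<le> t" "t \<le> p - 1" "int i < p"
  shows "int (card {b \<in> {0..t - 1}. (alternating p i + b) mod p \<in> {0..t - 1}}) = weight p t i"
proof -
  \<comment> \<open>For a distance d of at most p/2, \<open>t - d\<close> is the larger of
    \<open>t - d\<close> and \<open>t - p + d\<close>; if both are positive they add up to
    \<open>2 * t - p\<close>.\<close>
  have "2 * int (Suc i div 2) \<le> p"
    using assms(3) by linarith
  then show ?thesis
    unfolding card_interval_shift[OF assms(2) alternating_range[OF assms(3)]]
    using assms by (cases "even i") (auto simp: alternating_def weight_def)
qed

lemma r_count_eq_sum:
  assumes "finite A" "finite B"
  shows "r_count G A B C = (\<Sum>a\<in>A. card {b \<in> B. a \<otimes>\<^bsub>G\<^esub> b \<in> C})"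
proof -
  have "additive_triples G A B C =
      (\<lambda>(a, b). (a, b, a \<otimes>\<^bsub>G\<^esub> b)) ` (SIGMA a:A. {b \<in> B. a \<otimes>\<^bsub>G\<^esub> b \<in> C})"
    unfolding additive_triples_def by force
  then have "r_count G A B C = card (SIGMA a:A. {b \<in> B. a \<otimes>\<^bsub>G\<^esub> b \<in> C})"
    unfolding r_count_def by (simp add: card_image inj_on_def split_beta)
  then show ?thesis
    using assms by simp
qed

theorem theorem7:
  fixes p s t r :: int and B :: "int set"
  assumes "odd p"
    and "1 \<le> s" "s \<le> p - 1"
    and "1 \<le> t" "t \<le> p - 1"
    and "B = {0..t - 1}"
    and "f_bound p s t \<le> r" "r \<le> g_bound p s t"
  shows "\<exists>A. A \<subseteq> carrier (integer_mod_group (nat p)) \<and> int (card A) = s \<and>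
    int (r_count (integer_mod_group (nat p)) A B B) = r"
proof -
  define n where "n = nat s"
  have n: "s = int n" "1 \<le> n" "int n \<le> p - 1"
    using assms(2,3) by (auto simp: n_def)
  have step: "weight p t (Suc i) \<le> weight p t i \<and> weight p t i \<le> weight p t (Suc i) + 1" for i
  proof -
    have "Suc i div 2 \<le> Suc (Suc i) div 2" "Suc (Suc i) div 2 \<le> Suc i div 2 + 1"
      by presburger+
    then show ?thesis
      unfolding weight_def by linarith
  qed
  have card: "card {nat p - n..<nat p} = n"
    using n by simp
  \<comment> \<open>The moves start from the last \<open>n\<close> places, with sum
    \<open>f_bound\<close>, and lead towards the first \<open>n\<close>, with sum
    \<open>g_bound\<close>.\<close>
  have "\<exists>I \<subseteq> {..<nat p}. card I = card {nat p - n..<nat p} \<and> sum (weight p t) I = r"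
    using assms n card sum_weight_bottom[of p t n] sum_weight_top[of t p n]
    by (intro subset_sum_between step) auto
  then obtain I where I: "I \<subseteq> {..<nat p}" "card I = n" "sum (weight p t) I = r"
    using card by auto
  define A where "A = alternating p ` I"
  have fin: "finite I"
    by (rule finite_subset[OF I(1)]) simp
  have inj: "inj_on (alternating p) I"
    using inj_on_subset[OF inj_on_alternating I(1)] .
  have less: "int i < p" if "i \<in> I" for i
    using I(1) that by auto
  have "int (r_count (integer_mod_group (nat p)) A B B)
      = (\<Sum>i\<in>I. int (card {b \<in> B. (alternating p i + b) mod p \<in> B}))"
    using n fin assms(6) inj by (simp add: r_count_eq_sum A_def sum.reindex)
  also have "\<dots> = sum (weight p t) I"
    unfolding assms(6) using assms(4,5) less
    by (intro sum.cong refl card_interval_shift_alternating) auto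
  finally have "int (r_count (integer_mod_group (nat p)) A B B) = r"
    using I(3) by simp
  moreover have "A \<subseteq> carrier (integer_mod_group (nat p))"
    using n alternating_range[OF less] by (auto simp: A_def carrier_integer_mod_group)
  moreover have "int (card A) = s"
    using inj I(2) n(1) by (simp add: A_def card_image)
  ultimately show ?thesis
    by blast
qed

end
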